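(* Let $G_1$ be an $r_1$-regular graph with $n_1$ vertices and $G_2$ an $r_2$-regular graph with $n_2$ vertices. Then the adjacency spectrum (with multiplicities) of $G_1\underset{=}{\vee}G_2$ consists of: (i) $\lambda_j(G_2)$ for each $j=2,3,\dots,n_2$; (ii) the two roots of the equation $$x^2-\lambda_i(G_1)\,x-\big(\lambda_i^2(G_1)+2\lambda_i(G_1)+1\big)=0$$ for each $i=2,3,\dots,n_1$; (iii) the three roots of the equation $$x^3-(r_1+r_2)x^2+\big(r_1r_2-(n_1-r_1-1)^2-n_1n_2\big)x+r_2(n_1-r_1-1)^2=0.$$
   Context: Graphs are finite, undirected and simple. $\lambda_1(G)\ge\lambda_2(G)\ge\dots\ge\lambda_n(G)$ denote the eigenvalues of the adjacency matrix $A(G)$; the adjacency spectrum is the multiset of these eigenvalues. For vertex-disjoint graphs $G_1$ (with $V(G_1)=\{u_1,\dots,u_{n_1}\}$) and $G_2$, the join $G_1\vee G_2$ is the disjoint union together with all edges between $V(G_1)$ and $V(G_2)$. The NNS (Non Neighbors Splitting) join $G_1\underset{=}{\vee}G_2$ is obtained from $G_1\vee G_2$ by adding new vertices $u_1',\dots,u_{n_1}'$ and joining $u_i'$ to $u_j$ if and only if $i\ne j$ and $u_iu_j\notin E(G_1)$. *)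

theory Defs
  imports "Graph_Theory.Pair_Digraph" "Jordan_Normal_Form.Char_Poly"
begin

text \<open>A finite undirected simple graph is a \<^locale>\<open>pair_graph\<close>: finite, loop-free, with a
  symmetric arc relation; the edge $uv$ is the pair of arcs $(u,v)$, $(v,u)$, so the degree of a
  vertex is its out-degree.\<close>

definition regular :: "nat \<Rightarrow> 'a pair_pre_digraph \<Rightarrow> bool" where
  "regular r G \<longleftrightarrow> (\<forall>v\<in>pverts G. out_degree (with_proj G) v = r)"


section \<open>Adjacency matrix and adjacency spectrum\<close>

definition vertex_enumeration :: "'a pair_pre_digraph \<Rightarrow> 'a list \<Rightarrow> bool" where
  "vertex_enumeration G vs \<longleftrightarrow> distinct vs \<and> set vs = pverts G"

definition adjacency_matrix :: "'a pair_pre_digraph \<Rightarrow> 'a list \<Rightarrow> real mat" where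
  "adjacency_matrix G vs = mat (length vs) (length vs)
     (\<lambda>(i, j). if (vs ! i, vs ! j) \<in> parcs G then 1 else 0)"

text \<open>The eigenvalues counted with algebraic multiplicity. The enumeration of the vertices is
  irrelevant, see \<open>adjacency_spectrum_eq\<close> below. Only real roots are collected; as the adjacency
  matrix of an undirected graph is symmetric, there are no others.\<close>

definition adjacency_spectrum :: "'a pair_pre_digraph \<Rightarrow> real multiset" where
  "adjacency_spectrum G =
     proots (char_poly (adjacency_matrix G (SOME vs. vertex_enumeration G vs)))"

text \<open>\<open>adj_eigenvalue G j\<close> is $\lambda_j(G)$ for $1 \le j \le n$: the $j$-th largest eigenvalue,
  counted from 1.\<close>

definition adj_eigenvalue :: "'a pair_pre_digraph \<Rightarrow> nat \<Rightarrow> real" where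
  "adj_eigenvalue G j = rev (sorted_list_of_multiset (adjacency_spectrum G)) ! (j - 1)"

lemma char_poly_permute:
  fixes A :: "'a :: comm_ring_1 mat"
  assumes A: "A \<in> carrier_mat n n" and p: "p permutes {0..<n}"
  shows "char_poly (mat n n (\<lambda>(i, j). A $$ (p i, p j))) = char_poly A"
proof -
  define M where "M = char_poly_matrix A"
  define B where "B = mat n n (\<lambda>(i, j). M $$ (p i, j))"
  define C where "C = mat n n (\<lambda>(i, j). transpose_mat B $$ (p i, j))"
  have M: "M \<in> carrier_mat n n" and B: "B \<in> carrier_mat n n" and C: "C \<in> carrier_mat n n"
    using A by (auto simp: M_def B_def C_def)
  have pn: "p i < n" if "i < n" for i
    using permutes_in_image[OF p, of i] that by simp
  have pinj: "p i = p j \<longleftrightarrow> i = j" for i j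
    using permutes_inj[OF p] by (auto dest: injD)
  have "det C = signof p * (signof p * det M)"
    using det_permute_rows[OF _ p, of "transpose_mat B"] det_permute_rows[OF M p] B
      det_transpose[OF B]
    by (simp add: C_def flip: B_def)
  also have "\<dots> = det M"
    by (simp add: sign_def)
  finally have "det (transpose_mat C) = det M"
    using C by (simp add: det_transpose)
  moreover have "transpose_mat C = char_poly_matrix (mat n n (\<lambda>(i, j). A $$ (p i, p j)))"
    using A by (intro eq_matI) (auto simp: C_def B_def M_def char_poly_matrix_def pn pinj)
  ultimately show ?thesis
    by (simp add: char_poly_def M_def)
qed

lemma adjacency_spectrum_eq:
  assumes vs: "vertex_enumeration G vs"
  shows "adjacency_spectrum G = proots (char_poly (adjacency_matrix G vs))"
proof -
  define ws where "ws = (SOME vs. vertex_enumeration G vs)"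
  have ws: "vertex_enumeration G ws"
    unfolding ws_def by (rule someI[of _ vs]) (rule vs)
  have "mset ws = mset vs"
    using vs ws set_eq_iff_mset_eq_distinct[of ws vs] by (simp add: vertex_enumeration_def)
  then obtain p where p: "p permutes {..<length vs}" and ws_eq: "permute_list p vs = ws"
    by (rule mset_eq_permutation)
  have pn: "p i < length vs" if "i < length vs" for i
    using permutes_in_image[OF p, of i] that by simp
  have len: "length ws = length vs"
    using ws_eq by auto
  have nth: "ws ! i = vs ! p i" if "i < length vs" for i
    using permute_list_nth[OF p that] ws_eq by simp
  have "adjacency_matrix G ws =
      mat (length vs) (length vs) (\<lambda>(i, j). adjacency_matrix G vs $$ (p i, p j))"
    by (intro eq_matI) (auto simp: adjacency_matrix_def len nth pn)
  then have "char_poly (adjacency_matrix G ws) = char_poly (adjacency_matrix G vs)"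
    using char_poly_permute[of "adjacency_matrix G vs" "length vs" p] p
    by (simp add: adjacency_matrix_def atLeast0LessThan)
  then show ?thesis
    by (simp add: adjacency_spectrum_def ws_def)
qed


section \<open>Join and NNS join\<close>

text \<open>The sum type makes the two vertex sets disjoint.\<close>

definition graph_join ::
  "'a pair_pre_digraph \<Rightarrow> 'b pair_pre_digraph \<Rightarrow> ('a + 'b) pair_pre_digraph" where
  "graph_join G1 G2 = \<lparr>
     pverts = pverts G1 <+> pverts G2,
     parcs = {(Inl u, Inl v) | u v. (u, v) \<in> parcs G1}
           \<union> {(Inr u, Inr v) | u v. (u, v) \<in> parcs G2}
           \<union> {(Inl u, Inr v) | u v. u \<in> pverts G1 \<and> v \<in> pverts G2}
           \<union> {(Inr v, Inl u) | u v. u \<in> pverts G1 \<and> v \<in> pverts G2}\<rparr>"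

text \<open>\<open>Inl\<close> tags the vertices of the join; the new vertex $u'$ is \<open>Inr u\<close>.\<close>

definition nns_join ::
  "'a pair_pre_digraph \<Rightarrow> 'b pair_pre_digraph \<Rightarrow> (('a + 'b) + 'a) pair_pre_digraph" where
  "nns_join G1 G2 = \<lparr>
     pverts = pverts (graph_join G1 G2) <+> pverts G1,
     parcs = {(Inl x, Inl y) | x y. (x, y) \<in> parcs (graph_join G1 G2)}
           \<union> {(Inr u, Inl (Inl v)) | u v.
                u \<in> pverts G1 \<and> v \<in> pverts G1 \<and> u \<noteq> v \<and> (u, v) \<notin> parcs G1}
           \<union> {(Inl (Inl v), Inr u) | u v.
                u \<in> pverts G1 \<and> v \<in> pverts G1 \<and> u \<noteq> v \<and> (u, v) \<notin> parcs G1}\<rparr>"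

lemma pair_graph_iff:
  "pair_graph G \<longleftrightarrow>
     finite (pverts G) \<and> parcs G \<subseteq> pverts G \<times> pverts G \<and> sym (parcs G) \<and> irrefl (parcs G)"
  (is "?L \<longleftrightarrow> ?R")
proof
  assume ?L
  then interpret pair_graph G .
  have "sym (parcs G)"
    by (rule symI) (rule arcs_symmetric)
  moreover have "irrefl (parcs G)"
    using pair_no_loops by (fastforce simp: irrefl_def)
  ultimately show ?R
    using pair_finite_verts by (auto dest: in_arcsD1 in_arcsD2)
next
  assume R: ?R
  then have "finite (parcs G)"
    by (meson finite_SigmaI finite_subset)
  then show ?L
    using R by unfold_locales (auto simp: symmetric_def irrefl_def)
qed

lemma pair_graph_graph_join:
  assumes "pair_graph G1" "pair_graph G2"
  shows "pair_graph (graph_join G1 G2)"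
  using assms unfolding pair_graph_iff graph_join_def
  by (auto simp: irrefl_def intro!: symI dest: symD)

lemma pair_graph_nns_join:
  assumes "pair_graph G1" "pair_graph G2"
  shows "pair_graph (nns_join G1 G2)"
proof -
  have 1: "sym (parcs (graph_join G1 G2))" "irrefl (parcs (graph_join G1 G2))"
    "parcs (graph_join G1 G2) \<subseteq> pverts (graph_join G1 G2) \<times> pverts (graph_join G1 G2)"
    "finite (pverts (graph_join G1 G2))"
    using pair_graph_graph_join[OF assms] by (auto simp: pair_graph_iff)
  have 2: "sym (parcs G1)" "finite (pverts G1)"
    using assms(1) by (auto simp: pair_graph_iff)
  have 3: "Inl v \<in> pverts (graph_join G1 G2)" if "v \<in> pverts G1" for v
    using that by (auto simp: graph_join_def)
  show ?thesis
    unfolding pair_graph_iff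
  proof (intro conjI)
    show "finite (pverts (nns_join G1 G2))"
      using 1(4) 2(2) by (simp add: nns_join_def)
    show "parcs (nns_join G1 G2) \<subseteq> pverts (nns_join G1 G2) \<times> pverts (nns_join G1 G2)"
      using 1(3) 3 by (auto simp: nns_join_def)
    show "sym (parcs (nns_join G1 G2))"
      using symD[OF 1(1)] by (auto simp: nns_join_def intro!: symI)
    show "irrefl (parcs (nns_join G1 G2))"
      using 1(2) by (auto simp: nns_join_def irrefl_def)
  qed
qed

end

theory Submission
  imports Defs
begin

text \<open>Order the vertices as $V(G_2), V(G_1), V(G_1)'$ and let $A_1$, $A_2$ be the adjacency matrices.
  Since $(xI - A_2)J = (x - r_2)J$, the block of $G_2$ is eliminated without inverting
  $xI - A_2$. The remaining $2 \times 2$ block matrix over $V(G_1)$ has determinant $\det(M + cJ)$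
  with $M = x^2 I - xA_1 - (I + A_1)^2$ and a scalar $c$. As $MJ = mJ$ with $m = x^2 - r_1x - (1+r_1)^2$,
  this is $(1 + cn_1/m) \det M$, and $\det M$ is the product of $x^2 - \lambda x - (1+\lambda)^2$ over the
  eigenvalues $\lambda$ of $A_1$. Its factor for $\lambda_1(G_1) = r_1$ is $m$, which combines with the
  factor $x - r_2$ and with $1 + cn_1/m$ to the cubic. All this is valid for large real $x$, hence
  as an identity of polynomials. The quadratics and the cubic have only real roots since they divide
  the characteristic polynomial of a real symmetric matrix.\<close>

section \<open>Determinants of all-ones perturbations and of quadratic matrix polynomials\<close>

lemma poly_char_poly_eq_det:
  fixes A :: "'a :: field mat"
  assumes A: "A \<in> carrier_mat n n"
  shows "poly (char_poly A) x = det (x \<cdot>\<^sub>m 1\<^sub>m n - A)"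
proof -
  have "- char_matrix A x = x \<cdot>\<^sub>m 1\<^sub>m n - A"
    using A by (intro eq_matI) (auto simp: char_matrix_def)
  then show ?thesis
    using char_poly_matrix[OF A, of x] by simp
qed

abbreviation ones :: "nat \<Rightarrow> nat \<Rightarrow> 'a :: one mat" where
  "ones n m \<equiv> mat n m (\<lambda>_. 1)"

text \<open>Both sides are the determinant of one bordered matrix \<open>F\<close> of size
  \<open>n + 1\<close>. Multiplying on the left by the unit triangular \<open>L\<close> clears its
  last column, and by \<open>K\<close> its last row; neither changes the determinant.\<close>

lemma det_one_plus_ones:
  fixes c :: "'a :: field"
  shows "det (1\<^sub>m n + c \<cdot>\<^sub>m ones n n) = 1 + c * of_nat n"
proof -
  define F :: "'a mat" where "F = four_block_mat (1\<^sub>m n) (- c \<cdot>\<^sub>m ones n 1) (ones 1 n) (1\<^sub>m 1)"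
  define L :: "'a mat" where "L = four_block_mat (1\<^sub>m n) (c \<cdot>\<^sub>m ones n 1) (0\<^sub>m 1 n) (1\<^sub>m 1)"
  define K :: "'a mat" where "K = four_block_mat (1\<^sub>m n) (0\<^sub>m n 1) (- ones 1 n) (1\<^sub>m 1)"
  have carr: "F \<in> carrier_mat (n + 1) (n + 1)" "L \<in> carrier_mat (n + 1) (n + 1)"
    "K \<in> carrier_mat (n + 1) (n + 1)"
    by (auto simp: F_def L_def K_def)
  have "L * F = four_block_mat (1\<^sub>m n + c \<cdot>\<^sub>m ones n n) (0\<^sub>m n 1) (ones 1 n) (1\<^sub>m 1)"
    unfolding L_def F_def
    by (subst mult_four_block_mat[where ?n1.0 = n and ?n2.0 = 1])
      (auto intro!: cong_four_block_mat eq_matI simp: scalar_prod_def)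
  then have "det (L * F) = det (1\<^sub>m n + c \<cdot>\<^sub>m ones n n)"
    by (simp add: det_four_block_mat_upper_right_zero[where n = n and m = 1])
  moreover have "K * F = four_block_mat (1\<^sub>m n) (- c \<cdot>\<^sub>m ones n 1) (0\<^sub>m 1 n)
      ((1 + c * of_nat n) \<cdot>\<^sub>m 1\<^sub>m 1)"
    unfolding K_def F_def
    by (subst mult_four_block_mat[where ?n1.0 = n and ?n2.0 = 1])
      (auto intro!: cong_four_block_mat eq_matI simp: scalar_prod_def)
  then have "det (K * F) = 1 + c * of_nat n"
    by (simp add: det_four_block_mat_lower_left_zero[where n = n and m = 1])
  moreover have "det L = 1" "det K = 1"
    by (simp_all add: L_def K_def det_four_block_mat_lower_left_zero[where n = n and m = 1]
        det_four_block_mat_upper_right_zero[where n = n and m = 1])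
  ultimately show ?thesis
    using det_mult[OF carr(2,1)] det_mult[OF carr(3,1)] by simp
qed

text \<open>Constant row sums mean \<open>M * ones n n\<close> is \<open>m\<close> times
  \<open>ones n n\<close>, so \<open>M\<close> can be factored out on the left and only a
  perturbation of the identity remains.\<close>

lemma det_add_smult_ones:
  fixes M :: "'a :: field mat"
  assumes M: "M \<in> carrier_mat n n"
    and rows: "\<And>i. i < n \<Longrightarrow> (\<Sum>j<n. M $$ (i, j)) = m" and "m \<noteq> 0"
  shows "det (M + c \<cdot>\<^sub>m ones n n) = det M * (1 + c / m * of_nat n)"
proof -
  have "M + c \<cdot>\<^sub>m ones n n = M * (1\<^sub>m n + (c / m) \<cdot>\<^sub>m ones n n)"
  proof (intro eq_matI)
    fix i j assume "i < dim_row (M * (1\<^sub>m n + (c / m) \<cdot>\<^sub>m ones n n))"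
      "j < dim_col (M * (1\<^sub>m n + (c / m) \<cdot>\<^sub>m ones n n))"
    then have ij: "i < n" "j < n"
      using M by auto
    have "(M * (1\<^sub>m n + (c / m) \<cdot>\<^sub>m ones n n)) $$ (i, j) =
        (\<Sum>k<n. M $$ (i, k) * (if k = j then 1 else 0)) + (\<Sum>k<n. M $$ (i, k)) * (c / m)"
      using M ij by (simp add: scalar_prod_def atLeast0LessThan)
        (simp add: algebra_simps sum.distrib sum_distrib_left sum_divide_distrib)
    then show "(M + c \<cdot>\<^sub>m ones n n) $$ (i, j) = (M * (1\<^sub>m n + (c / m) \<cdot>\<^sub>m ones n n)) $$ (i, j)"
      using M ij rows[OF ij(1)] \<open>m \<noteq> 0\<close> by (simp add: if_distrib cong: if_cong)
  qed (use M in auto)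
  then show ?thesis
    using det_mult[OF M, of "1\<^sub>m n + (c / m) \<cdot>\<^sub>m ones n n"] by (simp add: det_one_plus_ones)
qed

text \<open>The matrix is a quadratic polynomial in \<open>A\<close>. Over the reals it factors into
  two shifts \<open>u I - A\<close> and \<open>v I - A\<close>, up to sign, so its determinant is a
  product of two values of \<open>char_poly A\<close>. Positivity of \<open>x\<close> makes the
  discriminant \<open>5 * x^2 + 4 * x\<close> nonnegative, hence \<open>u\<close> and
  \<open>v\<close> real.\<close>

lemma det_quadratic_of_char_poly:
  fixes A :: "real mat"
  assumes A: "A \<in> carrier_mat n n" and cp: "char_poly A = (\<Prod>a\<leftarrow>as. [:- a, 1:])"
    and len: "length as = n" and "x > 0"
  shows "det (x\<^sup>2 \<cdot>\<^sub>m 1\<^sub>m n - x \<cdot>\<^sub>m A - (1\<^sub>m n + A) * (1\<^sub>m n + A)) = (\<Prod>a\<leftarrow>as. x\<^sup>2 - x * a - (1 + a)\<^sup>2)"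
proof -
  \<comment> \<open>\<open>u\<close> and \<open>v\<close> are the roots of \<open>x\<^sup>2 - x * a - (1 + a)\<^sup>2\<close> as a polynomial in \<open>a\<close>.\<close>
  define s where "s = sqrt (5 * x\<^sup>2 + 4 * x)"
  define u v where "u = (- (x + 2) + s) / 2" and "v = (- (x + 2) - s) / 2"
  have s2: "s\<^sup>2 = 5 * x\<^sup>2 + 4 * x"
    using \<open>x > 0\<close> by (simp add: s_def)
  have sum_uv: "u + v = - (x + 2)"
    by (simp add: u_def v_def field_simps)
  have "u * v = ((x + 2)\<^sup>2 - s\<^sup>2) / 4"
    by (simp add: u_def v_def power2_eq_square field_simps)
  then have prod_uv: "u * v = 1 - x\<^sup>2"
    unfolding s2 by (simp add: power2_eq_square algebra_simps)
  have "x\<^sup>2 \<cdot>\<^sub>m 1\<^sub>m n - x \<cdot>\<^sub>m A - (1\<^sub>m n + A) * (1\<^sub>m n + A) =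
      (- 1) \<cdot>\<^sub>m ((u \<cdot>\<^sub>m 1\<^sub>m n - A) * (v \<cdot>\<^sub>m 1\<^sub>m n - A))"
  proof (intro eq_matI)
    fix i j assume "i < dim_row ((- 1) \<cdot>\<^sub>m ((u \<cdot>\<^sub>m 1\<^sub>m n - A) * (v \<cdot>\<^sub>m 1\<^sub>m n - A)))"
      "j < dim_col ((- 1) \<cdot>\<^sub>m ((u \<cdot>\<^sub>m 1\<^sub>m n - A) * (v \<cdot>\<^sub>m 1\<^sub>m n - A)))"
    then have ij: "i < n" "j < n"
      using A by auto
    define d :: "nat \<Rightarrow> nat \<Rightarrow> real" where "d = (\<lambda>i j. if i = j then 1 else 0)"
    define S where "S = (\<Sum>k<n. A $$ (i, k) * A $$ (k, j))"
    have d1: "(\<Sum>k<n. d i k * f k) = f i" for f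
      using ij by (simp add: d_def if_distrib[of "\<lambda>t. t * _"] cong: if_cong)
    have d2: "(\<Sum>k<n. f k * d k j) = f j" for f
      using ij by (simp add: d_def if_distrib cong: if_cong)
    \<comment> \<open>With \<open>d\<close> the identity matrix and \<open>S\<close> the entry of
      \<open>A * A\<close>, this one expansion covers both products of affine expressions in
      \<open>A\<close> that are compared below.\<close>
    have mult: "(\<Sum>k<n. (a * d i k + b * A $$ (i, k)) * (c * d k j + e * A $$ (k, j))) =
        a * c * d i j + (a * e + b * c) * A $$ (i, j) + b * e * S" for a b c e
    proof -
      have "(\<Sum>k<n. (a * d i k + b * A $$ (i, k)) * (c * d k j + e * A $$ (k, j))) =
          a * (\<Sum>k<n. d i k * (c * d k j + e * A $$ (k, j))) +
          (b * c) * (\<Sum>k<n. A $$ (i, k) * d k j) + b * e * S"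
        unfolding S_def sum_distrib_left sum.distrib[symmetric]
        by (intro sum.cong refl) (simp add: algebra_simps)
      then show ?thesis
        unfolding d1 d2 by (simp add: algebra_simps)
    qed
    have "((1\<^sub>m n + A) * (1\<^sub>m n + A)) $$ (i, j) =
        (\<Sum>k<n. (1 * d i k + 1 * A $$ (i, k)) * (1 * d k j + 1 * A $$ (k, j)))"
      using A ij by (auto simp: scalar_prod_def atLeast0LessThan d_def intro!: sum.cong)
    then have "((1\<^sub>m n + A) * (1\<^sub>m n + A)) $$ (i, j) = d i j + 2 * A $$ (i, j) + S"
      unfolding mult by simp
    moreover have "((u \<cdot>\<^sub>m 1\<^sub>m n - A) * (v \<cdot>\<^sub>m 1\<^sub>m n - A)) $$ (i, j) =
        (\<Sum>k<n. (u * d i k + (- 1) * A $$ (i, k)) * (v * d k j + (- 1) * A $$ (k, j)))"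
      using A ij by (auto simp: scalar_prod_def atLeast0LessThan d_def intro!: sum.cong)
    then have "((u \<cdot>\<^sub>m 1\<^sub>m n - A) * (v \<cdot>\<^sub>m 1\<^sub>m n - A)) $$ (i, j) =
        u * v * d i j - (u + v) * A $$ (i, j) + S"
      unfolding mult by (simp add: algebra_simps)
    ultimately show "(x\<^sup>2 \<cdot>\<^sub>m 1\<^sub>m n - x \<cdot>\<^sub>m A - (1\<^sub>m n + A) * (1\<^sub>m n + A)) $$ (i, j) =
        ((- 1) \<cdot>\<^sub>m ((u \<cdot>\<^sub>m 1\<^sub>m n - A) * (v \<cdot>\<^sub>m 1\<^sub>m n - A))) $$ (i, j)"
      using A ij by (simp add: sum_uv prod_uv d_def algebra_simps)
  qed (use A in auto)
  then have "det (x\<^sup>2 \<cdot>\<^sub>m 1\<^sub>m n - x \<cdot>\<^sub>m A - (1\<^sub>m n + A) * (1\<^sub>m n + A)) =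
      (- 1) ^ n * (poly (char_poly A) u * poly (char_poly A) v)"
    using A by (simp add: poly_char_poly_eq_det[OF A] det_mult[where n = n] minus_carrier_mat)
  \<comment> \<open>The sign \<open>(- 1) ^ n\<close> is shared out, one minus for each of the
    \<open>n\<close> factors; this is where \<open>length as = n\<close> enters.\<close>
  also have "\<dots> = (\<Prod>a\<leftarrow>as. - ((u - a) * (v - a)))"
    unfolding cp len[symmetric] by (induction as) (simp_all add: algebra_simps)
  also have "(\<lambda>a. - ((u - a) * (v - a))) = (\<lambda>a. x\<^sup>2 - x * a - (1 + a)\<^sup>2)"
  proof
    fix a
    have "- ((u - a) * (v - a)) = - (u * v) + (u + v) * a - a\<^sup>2"
      by (simp add: algebra_simps power2_eq_square)
    also have "\<dots> = x\<^sup>2 - x * a - (1 + a)\<^sup>2"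
      unfolding sum_uv prod_uv by (simp add: algebra_simps power2_eq_square)
    finally show "- ((u - a) * (v - a)) = x\<^sup>2 - x * a - (1 + a)\<^sup>2" .
  qed
  finally show ?thesis .
qed

section \<open>Eigenvalues of real symmetric matrices and of matrices with constant row sums\<close>

text \<open>Over the complex numbers the characteristic polynomial splits. For an eigenvector
  \<open>v\<close> to the root \<open>c\<close>, the Hermitian form of \<open>A\<close> at
  \<open>v\<close> equals \<open>c\<close> times the squared norm of \<open>v\<close> and is its own
  conjugate, so \<open>c\<close> is real.\<close>

lemma real_symmetric_char_poly_splits:
  fixes A :: "real mat"
  assumes A: "A \<in> carrier_mat n n"
    and sym: "\<And>i j. i < n \<Longrightarrow> j < n \<Longrightarrow> A $$ (i, j) = A $$ (j, i)"
  obtains as where "char_poly A = (\<Prod>a\<leftarrow>as. [:- a, 1:])" "length as = n"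
proof -
  define C where "C = map_mat complex_of_real A"
  have C: "C \<in> carrier_mat n n"
    using A by (simp add: C_def)
  obtain cs where cs: "char_poly C = (\<Prod>a\<leftarrow>cs. [:- a, 1:])" "length cs = n"
    using char_poly_factorized[OF C] by blast
  have real: "c \<in> \<real>" if "c \<in> set cs" for c
  proof -
    have "poly (char_poly C) c = 0"
      using that by (force simp: cs(1) poly_prod_list prod_list_zero_iff)
    then obtain v where v: "v \<in> carrier_vec n" "v \<noteq> 0\<^sub>v n" "C *\<^sub>v v = c \<cdot>\<^sub>v v"
      using eigenvalue_root_char_poly[OF C] C by (auto simp: eigenvalue_def eigenvector_def)
    define N where "N = (\<Sum>i<n. cnj (v $ i) * v $ i)"
    have entry: "(\<Sum>j<n. C $$ (i, j) * v $ j) = c * v $ i" if "i < n" for i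
      using arg_cong[OF v(3), of "\<lambda>w. w $ i"] that C v(1)
      by (simp add: scalar_prod_def atLeast0LessThan)
    have real_entry: "cnj (C $$ (i, j)) = C $$ (i, j)" if "i < n" "j < n" for i j
      using A that by (simp add: C_def)
    have "c * N = (\<Sum>i<n. \<Sum>j<n. cnj (v $ i) * C $$ (i, j) * v $ j)"
      unfolding N_def sum_distrib_left
    proof (intro sum.cong refl)
      fix i assume "i \<in> {..<n}"
      then have "c * (cnj (v $ i) * v $ i) = cnj (v $ i) * (\<Sum>j<n. C $$ (i, j) * v $ j)"
        using entry[of i] by simp
      then show "c * (cnj (v $ i) * v $ i) = (\<Sum>j<n. cnj (v $ i) * C $$ (i, j) * v $ j)"
        by (simp add: sum_distrib_left mult.assoc)
    qed
    moreover have "cnj (\<Sum>i<n. \<Sum>j<n. cnj (v $ i) * C $$ (i, j) * v $ j) =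
        (\<Sum>i<n. \<Sum>j<n. v $ i * C $$ (i, j) * cnj (v $ j))"
      by (simp add: real_entry)
    \<comment> \<open>Exchanging the two summation indices and using the symmetry of
      \<open>A\<close> turns the conjugate of the form back into the form itself.\<close>
    moreover have "\<dots> = (\<Sum>j<n. \<Sum>i<n. v $ i * C $$ (i, j) * cnj (v $ j))"
      by (rule sum.swap)
    moreover have "\<dots> = (\<Sum>i<n. \<Sum>j<n. cnj (v $ i) * C $$ (i, j) * v $ j)"
      using A sym by (intro sum.cong refl) (simp add: C_def mult.commute mult.left_commute)
    ultimately have "cnj (c * N) = c * N"
      by simp
    moreover have "cnj N = N"
      by (simp add: N_def mult.commute)
    moreover have "N \<noteq> 0"
    proof -
      obtain i where i: "i < n" "v $ i \<noteq> 0"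
        using v(1,2) by (metis carrier_vecD eq_vecI index_zero_vec(1,2))
      have "N = of_real (\<Sum>i<n. (cmod (v $ i))\<^sup>2)"
        unfolding N_def of_real_sum
        by (intro sum.cong refl) (simp only: complex_norm_square mult.commute)
      moreover have "(\<Sum>i<n. (cmod (v $ i))\<^sup>2) > 0"
        using i by (intro sum_pos2[of _ i]) auto
      ultimately show ?thesis
        by (metis of_real_eq_0_iff less_irrefl)
    qed
    ultimately show ?thesis
      by (simp add: Reals_cnj_iff)
  qed
  \<comment> \<open>Injectivity of the coefficientwise embedding carries the factorisation back to
    real polynomials.\<close>
  interpret of_real_poly: map_poly_inj_idom_hom complex_of_real ..
  have "map_poly complex_of_real (char_poly A) = char_poly C"
    unfolding C_def by (rule of_real_hom.char_poly_hom[OF A, symmetric])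
  also have "\<dots> = map_poly complex_of_real (\<Prod>a\<leftarrow>map Re cs. [:- a, 1:])"
    unfolding cs(1) using real by (induction cs) (simp_all add: hom_distribs)
  finally have "char_poly A = (\<Prod>a\<leftarrow>map Re cs. [:- a, 1:])"
    by simp
  then show ?thesis
    using that[of "map Re cs"] cs(2) by simp
qed

lemma proots_prod_linear_factors: "proots (\<Prod>a\<leftarrow>as. [:- a, 1:]) = mset (as :: 'a :: idom list)"
proof -
  have "0 \<notin> set (map (\<lambda>a. [:- a, 1:]) as)"
    by auto
  from proots_prod_list[OF this]
  have "proots (\<Prod>a\<leftarrow>as. [:- a, 1:]) = (\<Sum>a\<leftarrow>as. proots [:- a, 1:])"
    by (simp add: o_def)
  also have "\<dots> = mset as"
    by (induction as) simp_all
  finally show ?thesis .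
qed

text \<open>Read the eigenvector equation at a coordinate of largest absolute value
  \<open>m\<close>: nonnegative entries bound its right-hand side by \<open>r * m\<close>. This
  later identifies the degree of a regular graph as its largest eigenvalue.\<close>

lemma root_char_poly_le_row_sum:
  fixes A :: "real mat"
  assumes A: "A \<in> carrier_mat n n"
    and nonneg: "\<And>i j. i < n \<Longrightarrow> j < n \<Longrightarrow> A $$ (i, j) \<ge> 0"
    and rows: "\<And>i. i < n \<Longrightarrow> (\<Sum>j<n. A $$ (i, j)) = r"
    and root: "poly (char_poly A) c = 0"
  shows "c \<le> r"
proof -
  obtain v where v: "v \<in> carrier_vec n" "v \<noteq> 0\<^sub>v n" "A *\<^sub>v v = c \<cdot>\<^sub>v v"
    using eigenvalue_root_char_poly[OF A] A root by (auto simp: eigenvalue_def eigenvector_def)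
  obtain l where l: "l < n" "v $ l \<noteq> 0"
    using v(1,2) by (metis carrier_vecD eq_vecI index_zero_vec(1,2))
  define m where "m = Max ((\<lambda>i. \<bar>v $ i\<bar>) ` {..<n})"
  have "m \<in> (\<lambda>i. \<bar>v $ i\<bar>) ` {..<n}"
    unfolding m_def using l by (intro Max_in) auto
  then obtain i where i: "i < n" "\<bar>v $ i\<bar> = m"
    by auto
  have le: "\<bar>v $ j\<bar> \<le> m" if "j < n" for j
    unfolding m_def using that by (intro Max_ge) auto
  have "m > 0"
    using le[OF l(1)] l(2) by linarith
  have "c * v $ i = (\<Sum>j<n. A $$ (i, j) * v $ j)"
    using arg_cong[OF v(3), of "\<lambda>w. w $ i"] i(1) A v(1)
    by (simp add: scalar_prod_def atLeast0LessThan)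
  then have "\<bar>c\<bar> * m = \<bar>\<Sum>j<n. A $$ (i, j) * v $ j\<bar>"
    by (simp add: i(2)[symmetric] abs_mult[symmetric])
  also have "\<dots> \<le> (\<Sum>j<n. A $$ (i, j) * m)"
    using i(1) nonneg le
    by (intro order.trans[OF sum_abs] sum_mono) (simp add: abs_mult mult_left_mono)
  also have "\<dots> = r * m"
    using rows[OF i(1)] by (simp flip: sum_distrib_right)
  finally have "\<bar>c\<bar> \<le> r"
    using \<open>m > 0\<close> by simp
  then show ?thesis
    by simp
qed

text \<open>The all-ones vector is an eigenvector; \<open>n > 0\<close> ensures that it is
  nonzero.\<close>

lemma row_sum_root_char_poly:
  fixes A :: "'a :: field mat"
  assumes A: "A \<in> carrier_mat n n" and "n > 0"
    and rows: "\<And>i. i < n \<Longrightarrow> (\<Sum>j<n. A $$ (i, j)) = r"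
  shows "poly (char_poly A) r = 0"
proof -
  have "A *\<^sub>v vec n (\<lambda>_. 1) = r \<cdot>\<^sub>v vec n (\<lambda>_. 1)"
    using A rows by (intro eq_vecI) (auto simp: scalar_prod_def atLeast0LessThan)
  moreover have "vec n (\<lambda>_. 1) \<noteq> (0\<^sub>v n :: 'a vec)"
    using \<open>n > 0\<close> by (metis index_vec index_zero_vec(1) zero_neq_one)
  ultimately have "eigenvector A (vec n (\<lambda>_. 1)) r"
    using A by (simp add: eigenvector_def)
  then show ?thesis
    using eigenvalue_root_char_poly[OF A] by (auto simp: eigenvalue_def)
qed

section \<open>The adjacency matrix of the NNS join in block form\<close>

text \<open>\<open>W\<close> is zero on its last \<open>n1\<close> columns because new vertices have
  no neighbour in the second graph. \<open>B\<close> is the adjacency matrix of the complement of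
  the first graph.\<close>

definition nns_matrix :: "real mat \<Rightarrow> real mat \<Rightarrow> nat \<Rightarrow> nat \<Rightarrow> real mat" where
  "nns_matrix A1 A2 n1 n2 =
     (let W = mat n2 (n1 + n1) (\<lambda>(i, j). if j < n1 then 1 else 0);
          B = ones n1 n1 - 1\<^sub>m n1 - A1
      in four_block_mat A2 W W\<^sup>T (four_block_mat A1 B B (0\<^sub>m n1 n1)))"

lemma nns_matrix_carrier:
  assumes "A1 \<in> carrier_mat n1 n1" "A2 \<in> carrier_mat n2 n2"
  shows "nns_matrix A1 A2 n1 n2 \<in> carrier_mat (n2 + (n1 + n1)) (n2 + (n1 + n1))"
  using assms by (simp add: nns_matrix_def Let_def)

definition nns_vertices :: "'a list \<Rightarrow> 'b list \<Rightarrow> (('a + 'b) + 'a) list" where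
  "nns_vertices vs ws =
     map (\<lambda>w. Inl (Inr w)) ws @ map (\<lambda>v. Inl (Inl v)) vs @ map Inr vs"

lemma vertex_enumeration_nns_join:
  assumes "vertex_enumeration G1 vs" "vertex_enumeration G2 ws"
  shows "vertex_enumeration (nns_join G1 G2) (nns_vertices vs ws)"
  using assms
  by (auto simp: vertex_enumeration_def nns_vertices_def nns_join_def graph_join_def
      distinct_map inj_on_def)

text \<open>Entrywise comparison over the nine pairs of blocks. Absence of loops in
  \<open>G1\<close> makes the diagonal of \<open>B\<close> vanish, and symmetry of its arcs lets the
  same \<open>B\<close> serve on both sides of the diagonal.\<close>

lemma adjacency_matrix_nns_join:
  assumes G1: "pair_graph G1"
    and vs: "vertex_enumeration G1 vs" and ws: "vertex_enumeration G2 ws"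
  shows "adjacency_matrix (nns_join G1 G2) (nns_vertices vs ws) =
    nns_matrix (adjacency_matrix G1 vs) (adjacency_matrix G2 ws) (length vs) (length ws)"
    (is "?L = ?R")
proof (rule eq_matI)
  have irr: "(v, v) \<notin> parcs G1" for v
    using G1 by (auto simp: pair_graph_iff irrefl_def)
  have sym: "(u, v) \<in> parcs G1 \<longleftrightarrow> (v, u) \<in> parcs G1" for u v
    using G1 by (auto simp: pair_graph_iff dest: symD)
  have in1: "vs ! i \<in> pverts G1" if "i < length vs" for i
    using vs nth_mem[OF that] by (simp add: vertex_enumeration_def)
  have in2: "ws ! i \<in> pverts G2" if "i < length ws" for i
    using ws nth_mem[OF that] by (simp add: vertex_enumeration_def)
  have eq1: "vs ! i = vs ! j \<longleftrightarrow> i = j" if "i < length vs" "j < length vs" for i j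
    using vs that by (simp add: vertex_enumeration_def nth_eq_iff_index_eq)
  have arcs:
    "(Inl (Inl u), Inl (Inl v)) \<in> parcs (nns_join G1 G2) \<longleftrightarrow> (u, v) \<in> parcs G1"
    "(Inl (Inr w), Inl (Inr z)) \<in> parcs (nns_join G1 G2) \<longleftrightarrow> (w, z) \<in> parcs G2"
    "(Inl (Inl u), Inl (Inr z)) \<in> parcs (nns_join G1 G2) \<longleftrightarrow> u \<in> pverts G1 \<and> z \<in> pverts G2"
    "(Inl (Inr z), Inl (Inl u)) \<in> parcs (nns_join G1 G2) \<longleftrightarrow> u \<in> pverts G1 \<and> z \<in> pverts G2"
    "(Inr u, Inl (Inl v)) \<in> parcs (nns_join G1 G2) \<longleftrightarrow>
       u \<in> pverts G1 \<and> v \<in> pverts G1 \<and> u \<noteq> v \<and> (u, v) \<notin> parcs G1"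
    "(Inl (Inl u), Inr v) \<in> parcs (nns_join G1 G2) \<longleftrightarrow>
       u \<in> pverts G1 \<and> v \<in> pverts G1 \<and> u \<noteq> v \<and> (u, v) \<notin> parcs G1"
    "(Inr u, Inl (Inr w)) \<notin> parcs (nns_join G1 G2)"
    "(Inl (Inr w), Inr u) \<notin> parcs (nns_join G1 G2)"
    "(Inr u, Inr v) \<notin> parcs (nns_join G1 G2)" for u v w z
    using sym[of u v] by (auto simp: nns_join_def graph_join_def)
  have nth:
    "i < length ws \<Longrightarrow> nns_vertices vs ws ! i = Inl (Inr (ws ! i))"
    "\<not> i < length ws \<Longrightarrow> i - length ws < length vs \<Longrightarrow>
       nns_vertices vs ws ! i = Inl (Inl (vs ! (i - length ws)))"
    "\<not> i < length ws \<Longrightarrow> \<not> i - length ws < length vs \<Longrightarrow> i < length ws + (length vs + length vs) \<Longrightarrow>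
       nns_vertices vs ws ! i = Inr (vs ! (i - length ws - length vs))" for i
    by (auto simp: nns_vertices_def nth_append)
  show "?L $$ (i, j) = ?R $$ (i, j)" if "i < dim_row ?R" "j < dim_col ?R" for i j
  proof -
    have ij: "i < length ws + (length vs + length vs)" "j < length ws + (length vs + length vs)"
      using that by (simp_all add: nns_matrix_def Let_def adjacency_matrix_def)
    then have "?L $$ (i, j) = (if (nns_vertices vs ws ! i, nns_vertices vs ws ! j)
        \<in> parcs (nns_join G1 G2) then 1 else 0)"
      by (simp add: adjacency_matrix_def nns_vertices_def)
    also have "\<dots> = ?R $$ (i, j)"
    proof -
      have split: "k < length ws \<or> \<not> k < length ws \<and> k - length ws < length vs \<or>
          \<not> k < length ws \<and> \<not> k - length ws < length vs" for k
        by blast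
      show ?thesis
        using split[of i] split[of j] ij
        by (elim disjE conjE)
          (simp_all add: nth arcs in1 in2 eq1 irr nns_matrix_def Let_def adjacency_matrix_def)
    qed
    finally show ?thesis .
  qed
qed (auto simp: adjacency_matrix_def nns_matrix_def nns_vertices_def Let_def)

lemma adjacency_matrix_carrier [simp]:
  "adjacency_matrix G vs \<in> carrier_mat (length vs) (length vs)"
  by (simp add: adjacency_matrix_def)

lemma adjacency_matrix_row_sum:
  assumes G: "pair_graph G" and reg: "regular r G" and vs: "vertex_enumeration G vs"
    and i: "i < length vs"
  shows "(\<Sum>j<length vs. adjacency_matrix G vs $$ (i, j)) = real r"
proof -
  have vi: "vs ! i \<in> pverts G"
    using vs nth_mem[OF i] by (simp add: vertex_enumeration_def)
  have bij: "bij_betw ((!) vs) {..<length vs} (pverts G)"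
    using vs by (auto simp: vertex_enumeration_def intro!: bij_betw_nth)
  have "(\<Sum>j<length vs. adjacency_matrix G vs $$ (i, j)) =
      (\<Sum>j<length vs. if (vs ! i, vs ! j) \<in> parcs G then 1 else 0)"
    using i by (simp add: adjacency_matrix_def)
  also have "\<dots> = (\<Sum>w\<in>pverts G. if (vs ! i, w) \<in> parcs G then 1 else 0)"
    by (rule sum.reindex_bij_betw[OF bij])
  also have "\<dots> = real (card {w \<in> pverts G. (vs ! i, w) \<in> parcs G})"
    using G by (simp add: pair_graph_iff flip: sum.inter_filter)
  \<comment> \<open>An arc leaving a fixed vertex is determined by its head, so neighbours and
    outgoing arcs are equally many.\<close>
  also have "{w \<in> pverts G. (vs ! i, w) \<in> parcs G} = snd ` out_arcs (with_proj G) (vs ! i)"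
    using G by (force simp: pair_graph_iff out_arcs_def)
  also have "card \<dots> = out_degree (with_proj G) (vs ! i)"
    unfolding out_degree_def by (intro card_image inj_onI) (auto simp: out_arcs_def)
  finally show ?thesis
    using reg vi by (simp add: regular_def)
qed

lemma adjacency_matrix_sym:
  assumes "pair_graph G" "i < length vs" "j < length vs"
  shows "adjacency_matrix G vs $$ (i, j) = adjacency_matrix G vs $$ (j, i)"
  using assms by (auto simp: adjacency_matrix_def pair_graph_iff dest: symD)

text \<open>Bridges the numbering from 1 in \<open>adj_eigenvalue\<close> and list positions from 0,
  recovering the descending list of the whole spectrum.\<close>

lemma adj_eigenvalue_list:
  "map (adj_eigenvalue G) [1..<Suc (size (adjacency_spectrum G))] =
     rev (sorted_list_of_multiset (adjacency_spectrum G))"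
  by (intro nth_equalityI) (simp_all add: adj_eigenvalue_def flip: size_mset del: upt_Suc)

section \<open>Block elimination and the characteristic polynomial of the NNS join\<close>

text \<open>With \<open>Q = x I - A2\<close>, constant row sums give \<open>Q * Y = W\<close> for
  the explicit multiple \<open>Y\<close> of \<open>W\<close>. The unit triangular \<open>E\<close>
  therefore clears the upper right block by column operations, leaving
  \<open>det Q * det R'\<close>.\<close>

lemma det_nns_matrix:
  fixes A1 A2 :: "real mat"
  assumes A1: "A1 \<in> carrier_mat n1 n1" and A2: "A2 \<in> carrier_mat n2 n2"
    and rows1: "\<And>i. i < n1 \<Longrightarrow> (\<Sum>j<n1. A1 $$ (i, j)) = r1"
    and cols1: "\<And>j. j < n1 \<Longrightarrow> (\<Sum>i<n1. A1 $$ (i, j)) = r1"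
    and rows2: "\<And>i. i < n2 \<Longrightarrow> (\<Sum>j<n2. A2 $$ (i, j)) = r2"
    and x: "x \<noteq> r2"
  shows "det (x \<cdot>\<^sub>m 1\<^sub>m (n2 + (n1 + n1)) - nns_matrix A1 A2 n1 n2) =
    det (x \<cdot>\<^sub>m 1\<^sub>m n2 - A2) *
    det (x\<^sup>2 \<cdot>\<^sub>m 1\<^sub>m n1 - x \<cdot>\<^sub>m A1 - (1\<^sub>m n1 + A1) * (1\<^sub>m n1 + A1)
      + (2 * r1 + 2 - n1 - x * n2 / (x - r2)) \<cdot>\<^sub>m ones n1 n1)"
proof -
  define B where "B = ones n1 n1 - 1\<^sub>m n1 - A1"
  define W :: "real mat" where "W = mat n2 (n1 + n1) (\<lambda>(i, j). if j < n1 then 1 else 0)"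
  define Q where "Q = x \<cdot>\<^sub>m 1\<^sub>m n2 - A2"
  define P where "P = x \<cdot>\<^sub>m 1\<^sub>m n1 - A1"
  define P' where "P' = P - (n2 / (x - r2)) \<cdot>\<^sub>m ones n1 n1"
  define Y where "Y = (1 / (x - r2)) \<cdot>\<^sub>m W"
  define R where "R = four_block_mat P (- B) (- B) (x \<cdot>\<^sub>m 1\<^sub>m n1)"
  define R' where "R' = four_block_mat P' (- B) (- B) (x \<cdot>\<^sub>m 1\<^sub>m n1)"
  define N where "N = four_block_mat Q (- W) (- W\<^sup>T) R"
  define E where "E = four_block_mat (1\<^sub>m n2) Y (0\<^sub>m (n1 + n1) n2) (1\<^sub>m (n1 + n1))"
  have B: "B \<in> carrier_mat n1 n1" and W: "W \<in> carrier_mat n2 (n1 + n1)"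
    and Q: "Q \<in> carrier_mat n2 n2" and P: "P \<in> carrier_mat n1 n1" and P': "P' \<in> carrier_mat n1 n1"
    and Y: "Y \<in> carrier_mat n2 (n1 + n1)"
    using A1 A2 by (auto simp: B_def W_def Q_def P_def P'_def Y_def)
  have R: "R \<in> carrier_mat (n1 + n1) (n1 + n1)" and R': "R' \<in> carrier_mat (n1 + n1) (n1 + n1)"
    using B P P' by (auto simp: R_def R'_def)
  have N: "N \<in> carrier_mat (n2 + (n1 + n1)) (n2 + (n1 + n1))"
    and E: "E \<in> carrier_mat (n2 + (n1 + n1)) (n2 + (n1 + n1))"
    using Q R by (auto simp: N_def E_def)
  have "x \<cdot>\<^sub>m 1\<^sub>m (n2 + (n1 + n1)) - nns_matrix A1 A2 n1 n2 = N"
    using A1 A2 unfolding nns_matrix_def Let_def N_def Q_def R_def P_def B_def[symmetric] W_def[symmetric]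
    using B W by (intro eq_matI) auto
  moreover have "N * E = four_block_mat Q (0\<^sub>m n2 (n1 + n1)) (- W\<^sup>T) R'"
  proof -
    have "Q * Y + - W = 0\<^sub>m n2 (n1 + n1)"
    proof (intro eq_matI)
      fix i j assume "i < dim_row (0\<^sub>m n2 (n1 + n1))" "j < dim_col (0\<^sub>m n2 (n1 + n1))"
      then have ij: "i < n2" "j < n1 + n1"
        by auto
      \<comment> \<open>Each column of \<open>Y\<close> is constant, so only the row sum of
        \<open>Q\<close> matters.\<close>
      have "(Q * Y) $$ (i, j) = (\<Sum>k<n2. Q $$ (i, k)) * Y $$ (i, j)"
        using Q Y ij
        by (simp add: scalar_prod_def atLeast0LessThan sum_distrib_right) (simp add: Y_def W_def)
      also have "(\<Sum>k<n2. Q $$ (i, k)) = (\<Sum>k<n2. if i = k then x else 0) - (\<Sum>k<n2. A2 $$ (i, k))"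
        unfolding sum_subtractf[symmetric] Q_def using A2 ij(1) by (intro sum.cong refl) simp
      also have "\<dots> = x - r2"
        using ij(1) rows2[OF ij(1)] by simp
      finally show "(Q * Y + - W) $$ (i, j) = 0\<^sub>m n2 (n1 + n1) $$ (i, j)"
        using ij W Q Y x by (simp add: Y_def)
    qed (use Q W Y in auto)
    moreover have "- W\<^sup>T * Y + R = R'"
    proof (intro eq_matI)
      fix i j assume "i < dim_row R'" "j < dim_col R'"
      then have ij: "i < n1 + n1" "j < n1 + n1"
        using R' by auto
      have "(- W\<^sup>T * Y) $$ (i, j) = (if i < n1 \<and> j < n1 then - n2 / (x - r2) else 0)"
        using W Y ij by (simp add: scalar_prod_def) (simp add: W_def Y_def)
      then show "(- W\<^sup>T * Y + R) $$ (i, j) = R' $$ (i, j)"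
        using ij W Y R P B by (auto simp: R_def R'_def P'_def)
    qed (use R R' W Y in auto)
    ultimately show ?thesis
      unfolding N_def E_def using Q W R Y
      by (subst mult_four_block_mat[where ?n1.0 = n2 and ?n2.0 = "n1 + n1"])
        (auto intro!: cong_four_block_mat)
  qed
  then have "det (N * E) = det Q * det R'"
    using Q W R' by (simp add: det_four_block_mat_upper_right_zero[where n = n2 and m = "n1 + n1"])
  moreover have "det E = 1"
    using Y by (simp add: E_def det_four_block_mat_lower_left_zero[where n = n2 and m = "n1 + n1"])
  \<comment> \<open>The two lower blocks of \<open>R'\<close> commute, one being scalar, so no
    division by \<open>x\<close> is needed.\<close>
  moreover have "det R' = det (P' * (x \<cdot>\<^sub>m 1\<^sub>m n1) - (- B) * (- B))"
    unfolding R'_def using P' B by (intro det_four_block_mat) auto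
  moreover have "P' * (x \<cdot>\<^sub>m 1\<^sub>m n1) - (- B) * (- B) =
      x\<^sup>2 \<cdot>\<^sub>m 1\<^sub>m n1 - x \<cdot>\<^sub>m A1 - (1\<^sub>m n1 + A1) * (1\<^sub>m n1 + A1)
      + (2 * r1 + 2 - n1 - x * n2 / (x - r2)) \<cdot>\<^sub>m ones n1 n1" (is "?L = ?R")
  proof (intro eq_matI)
    fix i j assume "i < dim_row ?R" "j < dim_col ?R"
    then have ij: "i < n1" "j < n1"
      by auto
    \<comment> \<open>Since \<open>- B\<close> is \<open>C\<close> minus the all-ones matrix
      \<open>J\<close>, its square is \<open>C * C - C * J - J * C + n1 * J\<close>. Row and column
      sums of \<open>C\<close> turn the last three terms into a single multiple of
      \<open>J\<close>.\<close>
    define C where "C = 1\<^sub>m n1 + A1"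
    have C: "C \<in> carrier_mat n1 n1"
      using A1 by (simp add: C_def)
    have "(\<Sum>k<n1. C $$ (i, k)) = 1 + r1" "(\<Sum>k<n1. C $$ (k, j)) = 1 + r1"
      using A1 ij rows1[OF ij(1)] cols1[OF ij(2)] by (simp_all add: C_def sum.distrib)
    moreover have "((- B) * (- B)) $$ (i, j) =
        (\<Sum>k<n1. C $$ (i, k) * C $$ (k, j)) - (\<Sum>k<n1. C $$ (i, k)) - (\<Sum>k<n1. C $$ (k, j)) + n1"
    proof -
      have "((- B) * (- B)) $$ (i, j) = (\<Sum>k<n1. (C $$ (i, k) - 1) * (C $$ (k, j) - 1))"
        using B A1 ij
        by (auto simp: scalar_prod_def atLeast0LessThan B_def C_def algebra_simps intro!: sum.cong)
      then show ?thesis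
        by (simp add: algebra_simps sum.distrib sum_subtractf)
    qed
    moreover have "(C * C) $$ (i, j) = (\<Sum>k<n1. C $$ (i, k) * C $$ (k, j))"
      using C ij by (simp add: scalar_prod_def atLeast0LessThan)
    ultimately have "((- B) * (- B)) $$ (i, j) = (C * C) $$ (i, j) - 2 * r1 - 2 + n1"
      by simp
    moreover have "(P' * (x \<cdot>\<^sub>m 1\<^sub>m n1)) $$ (i, j) = x * P' $$ (i, j)"
    proof -
      have "P' * (x \<cdot>\<^sub>m 1\<^sub>m n1) = x \<cdot>\<^sub>m P'"
        using P' by (simp add: mult_smult_distrib[OF P' one_carrier_mat])
      then show ?thesis
        using P' ij by simp
    qed
    moreover have "?L $$ (i, j) = (P' * (x \<cdot>\<^sub>m 1\<^sub>m n1)) $$ (i, j) - ((- B) * (- B)) $$ (i, j)"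
      using B P' ij by (intro index_minus_mat) auto
    moreover have "?R $$ (i, j) = x\<^sup>2 * (if i = j then 1 else 0) - x * A1 $$ (i, j) - (C * C) $$ (i, j)
        + (2 * r1 + 2 - n1 - x * n2 / (x - r2))"
      using A1 C ij unfolding C_def[symmetric] by simp
    moreover have "P' $$ (i, j) = x * (if i = j then 1 else 0) - A1 $$ (i, j) - n2 / (x - r2)"
      using A1 ij by (simp add: P'_def P_def)
    ultimately show "?L $$ (i, j) = ?R $$ (i, j)"
      by (simp add: power2_eq_square algebra_simps)
  qed (use A1 B P' in auto)
  ultimately show ?thesis
    using det_mult[OF N E] by (simp add: Q_def)
qed

lemma poly_eqI_greater:
  fixes p q :: "real poly"
  assumes "\<And>x. x > c \<Longrightarrow> poly p x = poly q x"
  shows "p = q"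
proof (rule ccontr)
  assume "p \<noteq> q"
  then have "finite {x. poly (p - q) x = 0}"
    by (intro poly_roots_finite) simp
  moreover have "{c<..} \<subseteq> {x. poly (p - q) x = 0}"
    using assms by auto
  ultimately show False
    using infinite_Ioi finite_subset by blast
qed

text \<open>Compared at large \<open>x\<close>, the factor \<open>x - r2\<close> of
  \<open>char_poly A2\<close> and the factor \<open>m\<close> of \<open>det M\<close> cancel the
  denominators of the elimination. What they leave, \<open>(x - r2) * (m + c * n1)\<close>, is the
  cubic.\<close>

lemma char_poly_nns_matrix:
  fixes A1 A2 :: "real mat"
  assumes A1: "A1 \<in> carrier_mat n1 n1" and A2: "A2 \<in> carrier_mat n2 n2"
    and rows1: "\<And>i. i < n1 \<Longrightarrow> (\<Sum>j<n1. A1 $$ (i, j)) = r1"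
    and cols1: "\<And>j. j < n1 \<Longrightarrow> (\<Sum>i<n1. A1 $$ (i, j)) = r1"
    and rows2: "\<And>i. i < n2 \<Longrightarrow> (\<Sum>j<n2. A2 $$ (i, j)) = r2"
    and cp1: "char_poly A1 = (\<Prod>a\<leftarrow>r1 # as. [:- a, 1:])"
    and cp2: "char_poly A2 = (\<Prod>b\<leftarrow>r2 # bs. [:- b, 1:])"
    and nonneg: "r1 \<ge> 0" "r2 \<ge> 0"
  shows "char_poly (nns_matrix A1 A2 n1 n2) =
    (\<Prod>b\<leftarrow>bs. [:- b, 1:]) * (\<Prod>a\<leftarrow>as. [: - (a\<^sup>2 + 2 * a + 1), - a, 1 :]) *
    [: r2 * (n1 - r1 - 1)\<^sup>2, r1 * r2 - (n1 - r1 - 1)\<^sup>2 - real n1 * n2, - (r1 + r2), 1 :]"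
proof (rule poly_eqI_greater)
  \<comment> \<open>The threshold makes both denominators nonzero: \<open>x > r2\<close>, and
    \<open>m > 0\<close> because \<open>x * (x - r1)\<close> is at least \<open>x - r1\<close>,
    which exceeds the square of \<open>1 + r1\<close>.\<close>
  fix x :: real assume large: "x > 1 + r1 + r2 + (1 + r1)\<^sup>2"
  have x: "x > 1" "x > r2" "x - r1 > (1 + r1)\<^sup>2"
    using large nonneg zero_le_power2[of "1 + r1"] by linarith+
  define m where "m = x\<^sup>2 - x * r1 - (1 + r1)\<^sup>2"
  define c where "c = 2 * r1 + 2 - n1 - x * n2 / (x - r2)"
  define M where "M = x\<^sup>2 \<cdot>\<^sub>m 1\<^sub>m n1 - x \<cdot>\<^sub>m A1 - (1\<^sub>m n1 + A1) * (1\<^sub>m n1 + A1)"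
  have M: "M \<in> carrier_mat n1 n1"
    using A1 by (auto simp: M_def)
  have "1 * (x - r1) \<le> x * (x - r1)"
    using x zero_le_power2[of "1 + r1"] by (intro mult_right_mono) linarith+
  then have "m > 0"
    using x(3) by (simp add: m_def power2_eq_square algebra_simps)
  have len: "length (r1 # as) = n1"
    using degree_monic_char_poly[OF A1] degree_linear_factors[of uminus "r1 # as"] cp1 by simp
  \<comment> \<open>\<open>I + A1\<close> has row sums \<open>1 + r1\<close>, so its square has row
    sums \<open>(1 + r1)^2\<close>.\<close>
  have rowsM: "(\<Sum>j<n1. M $$ (i, j)) = m" if i: "i < n1" for i
  proof -
    define C where "C = 1\<^sub>m n1 + A1"
    have C: "C \<in> carrier_mat n1 n1"
      using A1 by (simp add: C_def)
    have rowsC: "(\<Sum>j<n1. C $$ (k, j)) = 1 + r1" if "k < n1" for k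
      using that A1 rows1[OF that] by (simp add: C_def sum.distrib)
    have "(\<Sum>j<n1. (C * C) $$ (i, j)) = (\<Sum>j<n1. \<Sum>k<n1. C $$ (i, k) * C $$ (k, j))"
      using C i by (simp add: scalar_prod_def atLeast0LessThan)
    also have "\<dots> = (\<Sum>k<n1. C $$ (i, k) * (\<Sum>j<n1. C $$ (k, j)))"
      by (subst sum.swap) (simp add: sum_distrib_left)
    also have "\<dots> = (1 + r1) * (1 + r1)"
      using rowsC i by (simp flip: sum_distrib_right)
    finally have "(\<Sum>j<n1. (C * C) $$ (i, j)) = (1 + r1)\<^sup>2"
      by (simp add: power2_eq_square)
    moreover have "(\<Sum>j<n1. M $$ (i, j)) = x\<^sup>2 * (\<Sum>j<n1. if i = j then 1 else 0)
        - x * (\<Sum>j<n1. A1 $$ (i, j)) - (\<Sum>j<n1. (C * C) $$ (i, j))"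
      unfolding M_def C_def[symmetric] sum_distrib_left sum_subtractf[symmetric]
      using A1 C i by (intro sum.cong refl) simp
    ultimately show ?thesis
      using i rows1[OF i] by (simp add: m_def)
  qed
  have "poly (char_poly (nns_matrix A1 A2 n1 n2)) x = poly (char_poly A2) x * det (M + c \<cdot>\<^sub>m ones n1 n1)"
    using x unfolding poly_char_poly_eq_det[OF nns_matrix_carrier[OF A1 A2]]
      poly_char_poly_eq_det[OF A2] M_def c_def
    by (intro det_nns_matrix[OF A1 A2 rows1 cols1 rows2]) auto
  also have "det (M + c \<cdot>\<^sub>m ones n1 n1) = det M * (1 + c / m * n1)"
    using \<open>m > 0\<close> by (intro det_add_smult_ones[OF M rowsM]) auto
  also have "det M = m * (\<Prod>a\<leftarrow>as. x\<^sup>2 - x * a - (1 + a)\<^sup>2)"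
    using det_quadratic_of_char_poly[OF A1 cp1 len] x unfolding M_def m_def by simp
  also have "poly (char_poly A2) x * (m * (\<Prod>a\<leftarrow>as. x\<^sup>2 - x * a - (1 + a)\<^sup>2) * (1 + c / m * n1)) =
      (\<Prod>b\<leftarrow>bs. x - b) * (\<Prod>a\<leftarrow>as. x\<^sup>2 - x * a - (1 + a)\<^sup>2) * ((x - r2) * (m + c * n1))"
    using \<open>m > 0\<close> by (simp add: cp2 poly_prod_list o_def field_simps)
  also have "(x - r2) * (m + c * n1) = (x - r2) * (m + (2 * r1 + 2 - n1) * n1) - x * n2 * n1"
    using x by (simp add: c_def field_simps)
  \<comment> \<open>The constants combine to a square:
    \<open>- (1 + r1)^2 + (2 * r1 + 2 - n1) * n1 = - (n1 - r1 - 1)^2\<close>.\<close>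
  also have "\<dots> = poly [: r2 * (n1 - r1 - 1)\<^sup>2, r1 * r2 - (n1 - r1 - 1)\<^sup>2 - real n1 * n2, - (r1 + r2), 1 :] x"
    by (simp add: m_def power2_eq_square algebra_simps)
  also have "(\<Prod>b\<leftarrow>bs. x - b) = poly (\<Prod>b\<leftarrow>bs. [:- b, 1:]) x"
    by (simp add: poly_prod_list o_def)
  also have "(\<Prod>a\<leftarrow>as. x\<^sup>2 - x * a - (1 + a)\<^sup>2) = poly (\<Prod>a\<leftarrow>as. [: - (a\<^sup>2 + 2 * a + 1), - a, 1 :]) x"
    by (simp add: poly_prod_list o_def power2_eq_square algebra_simps)
  finally show "poly (char_poly (nns_matrix A1 A2 n1 n2)) x =
    poly ((\<Prod>b\<leftarrow>bs. [:- b, 1:]) * (\<Prod>a\<leftarrow>as. [: - (a\<^sup>2 + 2 * a + 1), - a, 1 :]) *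
    [: r2 * (n1 - r1 - 1)\<^sup>2, r1 * r2 - (n1 - r1 - 1)\<^sup>2 - real n1 * n2, - (r1 + r2), 1 :]) x"
    unfolding poly_mult .
qed

section \<open>Spectra of graphs and of regular graphs\<close>

text \<open>Symmetry guarantees that collecting only real roots loses nothing.\<close>

lemma char_poly_adjacency_matrix_splits:
  assumes G: "pair_graph G" and vs: "vertex_enumeration G vs"
  shows "char_poly (adjacency_matrix G vs) = (\<Prod>a\<in>#adjacency_spectrum G. [:- a, 1:])"
    and "size (adjacency_spectrum G) = length vs"
proof -
  obtain as where as: "char_poly (adjacency_matrix G vs) = (\<Prod>a\<leftarrow>as. [:- a, 1:])"
    "length as = length vs"
    using real_symmetric_char_poly_splits[OF adjacency_matrix_carrier adjacency_matrix_sym[OF G]] .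
  have "adjacency_spectrum G = mset as"
    by (simp add: adjacency_spectrum_eq[OF vs] as(1) proots_prod_linear_factors)
  then show "char_poly (adjacency_matrix G vs) = (\<Prod>a\<in>#adjacency_spectrum G. [:- a, 1:])"
    "size (adjacency_spectrum G) = length vs"
    using as by (simp_all add: prod_mset_prod_list flip: mset_map)
qed

text \<open>The degree \<open>r\<close> is an eigenvalue and bounds all others, so it is the first
  of the descending list and the rest are the eigenvalues numbered from 2.\<close>

lemma char_poly_adjacency_matrix_regular:
  assumes G: "pair_graph G" and reg: "regular r G" and vs: "vertex_enumeration G vs"
    and ne: "vs \<noteq> []"
  shows "char_poly (adjacency_matrix G vs) =
    (\<Prod>a\<leftarrow>real r # map (adj_eigenvalue G) [2..<Suc (length vs)]. [:- a, 1:])"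
proof -
  let ?A = "adjacency_matrix G vs"
  note splits = char_poly_adjacency_matrix_splits[OF G vs]
  define es where "es = map (adj_eigenvalue G) [1..<Suc (length vs)]"
  have es: "es = rev (sorted_list_of_multiset (adjacency_spectrum G))"
    using adj_eigenvalue_list[of G] splits(2) by (simp add: es_def del: upt_Suc)
  then have mset_es: "mset es = adjacency_spectrum G"
    by simp
  have es_Cons: "es = adj_eigenvalue G 1 # map (adj_eigenvalue G) [2..<Suc (length vs)]"
    using ne by (simp add: es_def upt_conv_Cons numeral_2_eq_2 del: upt_Suc)
  have cp: "char_poly ?A = (\<Prod>a\<leftarrow>es. [:- a, 1:])"
    unfolding splits(1) mset_es[symmetric] by (simp add: prod_mset_prod_list flip: mset_map)
  have root_iff: "poly (char_poly ?A) a = 0 \<longleftrightarrow> a \<in> set es" for a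
    by (auto simp: cp poly_prod_list prod_list_zero_iff)
  have rows: "(\<Sum>j<length vs. ?A $$ (i, j)) = real r" if "i < length vs" for i
    by (rule adjacency_matrix_row_sum[OF G reg vs that])
  have "adj_eigenvalue G 1 \<le> r"
  proof (rule root_char_poly_le_row_sum[OF adjacency_matrix_carrier])
    show "poly (char_poly ?A) (adj_eigenvalue G 1) = 0"
      by (simp add: root_iff es_Cons)
  qed (use rows in \<open>auto simp: adjacency_matrix_def\<close>)
  moreover have "real r \<in> set es"
    unfolding root_iff[symmetric]
    by (rule row_sum_root_char_poly[OF adjacency_matrix_carrier]) (use ne rows in auto)
  moreover have "sorted_wrt (\<ge>) es"
    unfolding es sorted_wrt_rev by simp
  \<comment> \<open>\<open>r\<close> occurs in a descending list whose head is at most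
    \<open>r\<close>, so it equals the head.\<close>
  ultimately have "adj_eigenvalue G 1 = r"
    unfolding es_Cons by auto
  then show ?thesis
    using cp unfolding es_Cons by simp
qed

section \<open>Counting real roots and the spectrum of the NNS join\<close>

text \<open>Root counts and degrees both add over products, and no factor has more roots than its
  degree; equality for the product forces equality for each factor. This replaces any discussion of
  discriminants.\<close>

lemma size_proots_dvd:
  fixes p q :: "'a :: idom poly"
  assumes "size (proots p) = degree p" "p \<noteq> 0" "q dvd p"
  shows "size (proots q) = degree q"
proof -
  obtain k where k: "p = q * k"
    using assms(3) by (elim dvdE)
  have "degree q + degree k = size (proots q) + size (proots k)"
    using assms(1,2) k by (simp add: degree_mult_eq proots_mult)
  then show ?thesis
    using size_proots_le[of q] size_proots_le[of k] by linarith
qed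

theorem theorem6p1:
  fixes G1 :: "'a pair_pre_digraph" and G2 :: "'b pair_pre_digraph"
    and r1 r2 n1 n2 :: nat
  assumes "pair_graph G1" and "pair_graph G2"
    and "card (pverts G1) = n1" and "n1 \<ge> 1"
    and "card (pverts G2) = n2" and "n2 \<ge> 1"
    and "regular r1 G1" and "regular r2 G2"
  shows
    "let quadratic = (\<lambda>i. [: - ((adj_eigenvalue G1 i)\<^sup>2 + 2 * adj_eigenvalue G1 i + 1),
                             - adj_eigenvalue G1 i,
                             1 :]);
         cubic = [: real r2 * (real n1 - real r1 - 1)\<^sup>2,
                    real r1 * real r2 - (real n1 - real r1 - 1)\<^sup>2 - real n1 * real n2,
                    - (real r1 + real r2),
                    1 :]
     in adjacency_spectrum (nns_join G1 G2) =
            {# adj_eigenvalue G2 j. j \<in># mset_set {2..n2} #}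
          + (\<Sum>i\<in>{2..n1}. proots (quadratic i))
          + proots cubic
        \<and> (\<forall>i\<in>{2..n1}. size (proots (quadratic i)) = 2)
        \<and> size (proots cubic) = 3"
proof -
  obtain vs where vs: "vertex_enumeration G1 vs"
    using finite_distinct_list[of "pverts G1"] assms(1)
    by (auto simp: vertex_enumeration_def pair_graph_iff)
  obtain ws where ws: "vertex_enumeration G2 ws"
    using finite_distinct_list[of "pverts G2"] assms(2)
    by (auto simp: vertex_enumeration_def pair_graph_iff)
  have len: "length vs = n1" "length ws = n2"
    using vs ws assms(3,5) by (auto simp: vertex_enumeration_def dest: distinct_card)
  define H where "H = nns_join G1 G2"
  define us where "us = nns_vertices vs ws"
  define quadratic where "quadratic = (\<lambda>i. [: - ((adj_eigenvalue G1 i)\<^sup>2 + 2 * adj_eigenvalue G1 i + 1),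
      - adj_eigenvalue G1 i, 1 :])"
  define cubic where "cubic = [: real r2 * (real n1 - real r1 - 1)\<^sup>2,
      real r1 * real r2 - (real n1 - real r1 - 1)\<^sup>2 - real n1 * real n2, - (real r1 + real r2), 1 :]"
  define linear where "linear = (\<Prod>b\<leftarrow>map (adj_eigenvalue G2) [2..<Suc n2]. [:- b, 1:])"
  have us: "vertex_enumeration H us"
    unfolding H_def us_def by (rule vertex_enumeration_nns_join[OF vs ws])
  have pair_H: "pair_graph H"
    unfolding H_def by (rule pair_graph_nns_join[OF assms(1,2)])
  let ?p = "char_poly (adjacency_matrix H us)"
  have "?p = linear * (\<Prod>a\<leftarrow>map (adj_eigenvalue G1) [2..<Suc n1]. [: - (a\<^sup>2 + 2 * a + 1), - a, 1 :]) * cubic"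
    unfolding H_def us_def adjacency_matrix_nns_join[OF assms(1) vs ws] len linear_def cubic_def
  proof (rule char_poly_nns_matrix)
    \<comment> \<open>Column sums are row sums by symmetry of the adjacency matrix.\<close>
    show "(\<Sum>i<n1. adjacency_matrix G1 vs $$ (i, j)) = real r1" if "j < n1" for j
      using adjacency_matrix_row_sum[OF assms(1,7) vs, of j] that len
        adjacency_matrix_sym[OF assms(1), of j vs] by simp
    have "vs \<noteq> []" "ws \<noteq> []"
      using len assms(4,6) by auto
    then show "char_poly (adjacency_matrix G1 vs) =
          (\<Prod>a\<leftarrow>real r1 # map (adj_eigenvalue G1) [2..<Suc n1]. [:- a, 1:])"
      and "char_poly (adjacency_matrix G2 ws) =
          (\<Prod>b\<leftarrow>real r2 # map (adj_eigenvalue G2) [2..<Suc n2]. [:- b, 1:])"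
      unfolding len[symmetric]
      using char_poly_adjacency_matrix_regular assms vs ws by blast+
  qed (use len adjacency_matrix_carrier[of G1 vs] adjacency_matrix_carrier[of G2 ws]
      adjacency_matrix_row_sum[OF assms(1,7) vs] adjacency_matrix_row_sum[OF assms(2,8) ws] in simp_all)
  also have "(\<Prod>a\<leftarrow>map (adj_eigenvalue G1) [2..<Suc n1]. [: - (a\<^sup>2 + 2 * a + 1), - a, 1 :]) =
      (\<Prod>i\<leftarrow>[2..<Suc n1]. quadratic i)"
    by (simp add: quadratic_def o_def del: upt_Suc)
  \<comment> \<open>The product becomes one over the indices, which are distinct, and not over the
    eigenvalues, which may repeat.\<close>
  also have "\<dots> = (\<Prod>i\<in>set [2..<Suc n1]. quadratic i)"
    by (rule prod.distinct_set_conv_list[symmetric]) simp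
  also have "set [2..<Suc n1] = {2..n1}"
    by auto
  finally have p: "?p = linear * (\<Prod>i\<in>{2..n1}. quadratic i) * cubic" .
  have p0: "?p \<noteq> 0"
    using degree_monic_char_poly[OF adjacency_matrix_carrier, of H us] by force
  have size_p: "size (proots ?p) = degree ?p"
    using char_poly_adjacency_matrix_splits(2)[OF pair_H us]
      degree_monic_char_poly[OF adjacency_matrix_carrier, of H us]
    by (simp add: adjacency_spectrum_eq[OF us])
  note size_dvd = size_proots_dvd[OF size_p p0]
  have "quadratic i dvd ?p" if "i \<in> {2..n1}" for i
    unfolding p using that by (intro dvd_mult2 dvd_mult dvd_prodI) auto
  then have "size (proots (quadratic i)) = 2" if "i \<in> {2..n1}" for i
    using size_dvd[of "quadratic i"] that by (simp add: quadratic_def)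
  moreover have "size (proots cubic) = 3"
  proof -
    have "cubic dvd ?p"
      unfolding p by simp
    then show ?thesis
      using size_dvd by (simp add: cubic_def)
  qed
  moreover have "adjacency_spectrum H = {# adj_eigenvalue G2 j. j \<in># mset_set {2..n2} #}
      + (\<Sum>i\<in>{2..n1}. proots (quadratic i)) + proots cubic"
  proof -
    have "proots linear = {# adj_eigenvalue G2 j. j \<in># mset_set {2..n2} #}"
      unfolding linear_def proots_prod_linear_factors mset_map mset_upt
      by (simp add: atLeastLessThanSuc_atLeastAtMost)
    moreover have "proots (\<Prod>i\<in>{2..n1}. quadratic i) = (\<Sum>i\<in>{2..n1}. proots (quadratic i))"
      by (rule proots_prod) (auto simp: quadratic_def)
    ultimately show ?thesis
      using p0 unfolding adjacency_spectrum_eq[OF us] p by (simp add: proots_mult)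
  qed
  ultimately show ?thesis
    unfolding quadratic_def[symmetric] cubic_def[symmetric] H_def[symmetric] by (simp add: Let_def)
qed

end
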